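(* Let $(\mathcal T_\ell)_{\ell\in\mathbb N_0}$ be the sequence of meshes generated by the goal-oriented adaptive algorithm using Marking Strategy B. Suppose that the error estimators $\eta$ and $\zeta$ satisfy stability on non-refined elements and reduction on refined elements. Suppose further that the refinement strategy has the marking property. Then a priori convergence of $(u_\ell)_{\ell\in\mathbb N_0}$ and $(z_\ell)_{\ell\in\mathbb N_0}$, i.e., existence of $u_\infty,z_\infty\in X$ with $\|u_\infty-u_\ell\|_X\to0$ and $\|z_\infty-z_\ell\|_X\to0$ as $\ell\to\infty$, implies $$\eta_\ell\,\zeta_\ell\to0\qquad\text{as }\ell\to\infty .$$
   Context: General setting. $\Omega\subset\mathbb R^d$, $d\ge1$, is a bounded Lipschitz domain, $|\cdot|$ is the Lebesgue measure, $|\Omega|>0$, and $X$ is a normed space of functions on $\Omega$. A mesh is a finite set $\mathcal T$ of compact subsets $T\subseteq\overline\Omega$ (elements) with $|T|>0$, $|T\cap T'|=0$ for distinct $T,T'\in\mathcal T$, and $\bigcup\mathcal T=\overline\Omega$. A refinement strategy is a fixed map that assigns to a mesh $\mathcal T_H$ and a set $\mathcal M_H\subseteq\mathcal T_H$ of marked elements a mesh $\mathrm{refine}(\mathcal T_H,\mathcal M_H)$ (it is not assumed here that elements are unions of their children). $\mathbb T(\mathcal T_H)$ denotes the set of all meshes obtained from $\mathcal T_H$ by finitely many refinement steps with arbitrary sets of marked elements; $\mathcal T_0$ is a fixed initial mesh and $\mathbb T:=\mathbb T(\mathcal T_0)$. To every $\mathcal T_H\in\mathbb T$ are associated a discrete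 subspace $X_H\subset X$, functions $u_H,z_H\in X_H$, and refinement indicators $\eta_H(T),\zeta_H(T)\ge0$ for $T\in\mathcal T_H$. For $\xi\in\{\eta,\zeta\}$ and $\mathcal U_H\subseteq\mathcal T_H$ put $\xi_H(\mathcal U_H):=\big(\sum_{T\in\mathcal U_H}\xi_H(T)^2\big)^{1/2}$ and $\xi_H:=\xi_H(\mathcal T_H)$. Objects belonging to $\mathcal T_h$, $\mathcal T_\ell$ carry the index $h$, $\ell$. Further, $u\in X$ is fixed (exact solution), $G:X\to\mathbb R$ is continuous, and there are $G_H\in\mathbb R$ and a constant $C_{\rm go}>0$ with $|G(u)-G_H|\le C_{\rm go}\,\eta_H\zeta_H$ for all $\mathcal T_H\in\mathbb T$. Algorithm. Starting from $\mathcal T_0$, for $\ell=0,1,2,\dots$: compute $u_\ell,z_\ell$ and $\eta_\ell(T),\zeta_\ell(T)$; choose $\mathcal M_\ell\subseteq\mathcal T_\ell$ by the marking strategy; set $\mathcal T_{\ell+1}:=\mathrm{refine}(\mathcal T_\ell,\mathcal M_\ell)$. If $\eta_{\ell_0}\zeta_{\ell_0}=0$ for some minimal $\ell_0$, the algorithm stops and one sets $\mathcal T_\ell:=\mathcal T_{\ell_0}$ for $\ell\ge\ell_0$. Marking Strategy B: with a fixed $\theta\in(0,1]$ and a fixed function $W:\mathbb R_{\ge0}^2\to\mathbb R_{\ge0}$ with $W(1,1)=1$ and $W(x,y)\le C_W\max\{x,y\}$ for all $x,y\in[0,1]$, where $C_W>0$ is a constant, choose $\mathcal M_H\subseteq\mathcal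 T_H$ such that $0<\theta\le W\big(\eta_H(\mathcal M_H)^2/\eta_H^2,\ \zeta_H(\mathcal M_H)^2/\zeta_H^2\big)$. Marking property of the refinement strategy: $\mathcal M_H\subseteq\mathcal T_H\setminus\mathrm{refine}(\mathcal T_H,\mathcal M_H)$ for all $\mathcal T_H\in\mathbb T$ and $\mathcal M_H\subseteq\mathcal T_H$. Estimator properties. Let $0<q_{\rm red}<1$ and let $S:\mathbb R_{\ge0}^2\to\mathbb R_{\ge0}$ be continuous at $(0,0)$ with $S(0,0)=0$ and bounded on compact subsets of $\mathbb R_{\ge0}^2$. For $\xi\in\{\eta,\zeta\}$, all $\mathcal T_H\in\mathbb T$ and $\mathcal T_h\in\mathbb T(\mathcal T_H)$: - stability on non-refined elements: $\xi_h(\mathcal T_h\cap\mathcal T_H)\le\xi_H(\mathcal T_h\cap\mathcal T_H)+S(\|u_h-u_H\|_X,\|z_h-z_H\|_X)$; - reduction on refined elements: $\xi_h(\mathcal T_h\setminus\mathcal T_H)^2\le q_{\rm red}\,\xi_H(\mathcal T_H\setminus\mathcal T_h)^2+S(\|u_h-u_H\|_X,\|z_h-z_H\|_X)^2$. *)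

theory Defs
  imports "HOL-Analysis.Analysis"
begin

(* The boundary is locally the graph of a Lipschitz function, with the domain on one side.
   The direction e is the vertical axis of the local coordinates; g is a function of the
   d - 1 remaining coordinates, i.e. it is constant along e. Working on balls and with a
   globally defined g is no restriction, since real Lipschitz functions extend globally. *)
definition bounded_Lipschitz_domain :: "(real ^ 'd) set \<Rightarrow> bool" where
  "bounded_Lipschitz_domain \<Omega> \<longleftrightarrow>
     open \<Omega> \<and> connected \<Omega> \<and> bounded \<Omega> \<and> \<Omega> \<noteq> {} \<and>
     (\<forall>p\<in>frontier \<Omega>. \<exists>r>0. \<exists>(e :: real ^ 'd) (g :: real ^ 'd \<Rightarrow> real) L.
        norm e = 1 \<and> (\<forall>x t. g (x + t *\<^sub>R e) = g x) \<and> L-lipschitz_on UNIV g \<and>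
        \<Omega> \<inter> ball p r = {x \<in> ball p r. g x < x \<bullet> e})"

(* A normed space of functions on \<Omega> is a normed space 'x together with a map sending each
   v to the function it stands for, determined by its values on \<Omega>. For spaces of classes
   modulo null sets, val is a linear choice of representatives. *)
definition function_space_on :: "(real ^ 'd) set \<Rightarrow>
    ('x::real_normed_vector \<Rightarrow> real ^ 'd \<Rightarrow> 'v::real_vector) \<Rightarrow> bool" where
  "function_space_on \<Omega> val \<longleftrightarrow>
     (\<forall>x\<in>\<Omega>. linear (\<lambda>v. val v x)) \<and>
     (\<forall>v w. (\<forall>x\<in>\<Omega>. val v x = val w x) \<longrightarrow> v = w)"

type_synonym 'd mesh = "(real ^ 'd) set set"

definition is_mesh :: "(real ^ 'd) set \<Rightarrow> 'd mesh \<Rightarrow> bool" where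
  "is_mesh \<Omega> \<T> \<longleftrightarrow>
     finite \<T> \<and>
     (\<forall>T\<in>\<T>. compact T \<and> T \<subseteq> closure \<Omega> \<and> measure lebesgue T > 0) \<and>
     (\<forall>T\<in>\<T>. \<forall>T'\<in>\<T>. T \<noteq> T' \<longrightarrow> measure lebesgue (T \<inter> T') = 0) \<and>
     \<Union>\<T> = closure \<Omega>"

definition refinement_strategy ::
    "(real ^ 'd) set \<Rightarrow> ('d mesh \<Rightarrow> 'd mesh \<Rightarrow> 'd mesh) \<Rightarrow> bool" where
  "refinement_strategy \<Omega> refine \<longleftrightarrow>
     (\<forall>\<T> \<M>. is_mesh \<Omega> \<T> \<longrightarrow> \<M> \<subseteq> \<T> \<longrightarrow> is_mesh \<Omega> (refine \<T> \<M>))"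

inductive_set refinements :: "('d mesh \<Rightarrow> 'd mesh \<Rightarrow> 'd mesh) \<Rightarrow> 'd mesh \<Rightarrow> 'd mesh set"
  for refine :: "'d mesh \<Rightarrow> 'd mesh \<Rightarrow> 'd mesh" and \<T> :: "'d mesh" where
  base: "\<T> \<in> refinements refine \<T>"
| step: "\<T>' \<in> refinements refine \<T> \<Longrightarrow> \<M> \<subseteq> \<T>' \<Longrightarrow> refine \<T>' \<M> \<in> refinements refine \<T>"

definition marking_property ::
    "('d mesh \<Rightarrow> 'd mesh \<Rightarrow> 'd mesh) \<Rightarrow> 'd mesh \<Rightarrow> bool" where
  "marking_property refine \<T>0 \<longleftrightarrow>
     (\<forall>\<T>H\<in>refinements refine \<T>0. \<forall>\<M>. \<M> \<subseteq> \<T>H \<longrightarrow> \<M> \<subseteq> \<T>H - refine \<T>H \<M>)"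

(* \<xi> \<T> T is the indicator of the element T on the mesh \<T>. *)
type_synonym 'd indicators = "'d mesh \<Rightarrow> (real ^ 'd) set \<Rightarrow> real"

definition est_on :: "'d indicators \<Rightarrow> 'd mesh \<Rightarrow> 'd mesh \<Rightarrow> real" where
  "est_on \<xi> \<T> \<U> = sqrt (\<Sum>T\<in>\<U>. (\<xi> \<T> T)\<^sup>2)"

abbreviation est :: "'d indicators \<Rightarrow> 'd mesh \<Rightarrow> real" where
  "est \<xi> \<T> \<equiv> est_on \<xi> \<T> \<T>"

definition refinement_indicators ::
    "('d mesh \<Rightarrow> 'd mesh \<Rightarrow> 'd mesh) \<Rightarrow> 'd mesh \<Rightarrow> 'd indicators \<Rightarrow> bool" where
  "refinement_indicators refine \<T>0 \<xi> \<longleftrightarrow>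
     (\<forall>\<T>H\<in>refinements refine \<T>0. \<forall>T\<in>\<T>H. \<xi> \<T>H T \<ge> 0)"

(* Functions on the closed quadrant are total functions on pairs of reals whose values
   outside the quadrant are irrelevant. *)
abbreviation quadrant :: "(real \<times> real) set" where
  "quadrant \<equiv> {0..} \<times> {0..}"

definition perturbation_function :: "(real \<times> real \<Rightarrow> real) \<Rightarrow> bool" where
  "perturbation_function S \<longleftrightarrow>
     (\<forall>p\<in>quadrant. S p \<ge> 0) \<and>
     continuous (at (0, 0) within quadrant) S \<and> S (0, 0) = 0 \<and>
     (\<forall>K. K \<subseteq> quadrant \<longrightarrow> compact K \<longrightarrow> bounded (S ` K))"

definition stability_on_nonrefined ::
    "('d mesh \<Rightarrow> 'd mesh \<Rightarrow> 'd mesh) \<Rightarrow> 'd mesh \<Rightarrow> ('d mesh \<Rightarrow> 'x::real_normed_vector) \<Rightarrow>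
     ('d mesh \<Rightarrow> 'x) \<Rightarrow> (real \<times> real \<Rightarrow> real) \<Rightarrow> 'd indicators \<Rightarrow> bool" where
  "stability_on_nonrefined refine \<T>0 ud zd S \<xi> \<longleftrightarrow>
     (\<forall>\<T>H\<in>refinements refine \<T>0. \<forall>\<T>h\<in>refinements refine \<T>H.
        est_on \<xi> \<T>h (\<T>h \<inter> \<T>H) \<le> est_on \<xi> \<T>H (\<T>h \<inter> \<T>H)
          + S (norm (ud \<T>h - ud \<T>H), norm (zd \<T>h - zd \<T>H)))"

definition reduction_on_refined ::
    "('d mesh \<Rightarrow> 'd mesh \<Rightarrow> 'd mesh) \<Rightarrow> 'd mesh \<Rightarrow> ('d mesh \<Rightarrow> 'x::real_normed_vector) \<Rightarrow>
     ('d mesh \<Rightarrow> 'x) \<Rightarrow> real \<Rightarrow> (real \<times> real \<Rightarrow> real) \<Rightarrow> 'd indicators \<Rightarrow> bool" where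
  "reduction_on_refined refine \<T>0 ud zd q_red S \<xi> \<longleftrightarrow>
     (\<forall>\<T>H\<in>refinements refine \<T>0. \<forall>\<T>h\<in>refinements refine \<T>H.
        (est_on \<xi> \<T>h (\<T>h - \<T>H))\<^sup>2 \<le> q_red * (est_on \<xi> \<T>H (\<T>H - \<T>h))\<^sup>2
          + (S (norm (ud \<T>h - ud \<T>H), norm (zd \<T>h - zd \<T>H)))\<^sup>2)"

definition marking_function :: "real \<Rightarrow> (real \<times> real \<Rightarrow> real) \<Rightarrow> bool" where
  "marking_function C_W W \<longleftrightarrow>
     (\<forall>p\<in>quadrant. W p \<ge> 0) \<and> W (1, 1) = 1 \<and>
     (\<forall>x\<in>{0..1}. \<forall>y\<in>{0..1}. W (x, y) \<le> C_W * max x y)"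

definition marking_strategy_B ::
    "real \<Rightarrow> (real \<times> real \<Rightarrow> real) \<Rightarrow> 'd indicators \<Rightarrow> 'd indicators \<Rightarrow>
     'd mesh \<Rightarrow> 'd mesh \<Rightarrow> bool" where
  "marking_strategy_B \<theta> W \<eta> \<zeta> \<T>H \<M> \<longleftrightarrow>
     \<M> \<subseteq> \<T>H \<and> 0 < \<theta> \<and>
     \<theta> \<le> W ((est_on \<eta> \<T>H \<M>)\<^sup>2 / (est \<eta> \<T>H)\<^sup>2, (est_on \<zeta> \<T>H \<M>)\<^sup>2 / (est \<zeta> \<T>H)\<^sup>2)"

(* Once the product of the estimators vanishes, the mesh, and with it the estimators, no
   longer change; so the stepwise test is the stopping rule of the algorithm. *)
definition generated_by_algorithm ::
    "('d mesh \<Rightarrow> 'd mesh \<Rightarrow> 'd mesh) \<Rightarrow> 'd mesh \<Rightarrow> 'd indicators \<Rightarrow> 'd indicators \<Rightarrow>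
     ('d mesh \<Rightarrow> 'd mesh \<Rightarrow> bool) \<Rightarrow> (nat \<Rightarrow> 'd mesh) \<Rightarrow> bool" where
  "generated_by_algorithm refine \<T>0 \<eta> \<zeta> marking \<T> \<longleftrightarrow>
     \<T> 0 = \<T>0 \<and>
     (\<forall>l. if est \<eta> (\<T> l) * est \<zeta> (\<T> l) = 0 then \<T> (Suc l) = \<T> l
          else (\<exists>\<M>. marking (\<T> l) \<M> \<and> \<T> (Suc l) = refine (\<T> l) \<M>))"

end

theory Submission
  imports Defs "HOL-Complex_Analysis.Great_Picard"
begin

text \<open>
  The heart of the matter is that, for each of the two estimators, the contribution of the
  elements that are about to be removed vanishes:
  \<open>\<xi>\<^sub>\<ell>(\<T>\<^sub>\<ell> - \<T>\<^sub>\<ell>\<^sub>+\<^sub>1) \<longlonglongrightarrow> 0\<close> (\<open>removed_estimator_tendsto_0\<close>). By the marking property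
  every marked element is removed, so \<open>\<eta>\<^sub>\<ell>(\<M>\<^sub>\<ell>)\<close> and \<open>\<zeta>\<^sub>\<ell>(\<M>\<^sub>\<ell>)\<close> tend to zero. The
  marking criterion gives \<open>\<theta> \<le> C\<^sub>W max {\<eta>(\<M>)\<^sup>2/\<eta>\<^sup>2, \<zeta>(\<M>)\<^sup>2/\<zeta>\<^sup>2}\<close>, so in every step one of the
  two estimators is controlled by its marked part, while the other one is bounded
  (\<open>estimator_bounded\<close>, from stability and reduction relative to the initial mesh). Hence
  the product tends to zero (\<open>marking_B_product_le\<close>).

  Vanishing of the removed contributions needs only the following combinatorial property:
  for \<open>i \<le> j\<close>, both large, the squared indicators on the new elements \<open>\<T>\<^sub>j - \<T>\<^sub>i\<close> sum to at most
  \<open>q < 1\<close> times those on the removed elements \<open>\<T>\<^sub>i - \<T>\<^sub>j\<close>, up to a small error. Since an element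
  may disappear and come back, the sets \<open>\<T>\<^sub>\<ell>\<close> need not have a limit. But there are only
  countably many elements, so every sequence of indices has a subsequence \<open>\<alpha>\<close> such that, for
  each element, membership in \<open>\<T>\<^sub>\<alpha>\<^sub>k\<close> and membership in \<open>\<T>\<^sub>\<beta>\<^sub>k\<close>, where \<open>\<beta>\<^sub>k = \<alpha>\<^sub>k + 1\<close>, are both
  eventually constant in \<open>k\<close> (\<open>common_settling_subsequence\<close>). Let \<open>A\<close> and \<open>B\<close> be the two limit
  sets. The upper limit of the contribution of \<open>\<T>\<^sub>\<alpha>\<^sub>k - A\<close> is at most \<open>q\<close> times itself, hence
  zero. Consequently the elements of \<open>\<T>\<^sub>\<alpha>\<^sub>k\<close> that lie outside a suitable fixed \<open>\<T>\<^sub>\<alpha>\<^sub>n\<close> contribute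
  little, so that finitely many elements carry almost everything. This makes the same
  contraction argument work across the two sequences: the contributions of \<open>\<T>\<^sub>\<alpha>\<^sub>k - B\<close> and of
  \<open>\<T>\<^sub>\<beta>\<^sub>k - A\<close> bound each other with factor \<open>q\<close>, and both vanish. Finally, among the finitely many
  elements of \<open>\<T>\<^sub>\<alpha>\<^sub>n\<close>, those missing from \<open>\<T>\<^sub>\<beta>\<^sub>k\<close> for large \<open>k\<close> are those outside \<open>B\<close>.
\<close>

section \<open>Weighted set sequences with asymptotic reduction\<close>

text \<open>The hypothesis \<open>contr\<close> says that the upper limit of \<open>f\<close> is at most \<open>q\<close> times itself; it
  avoids mentioning the upper limit.\<close>

lemma tendsto_0_if_eventual_contraction:
  fixes f :: "nat \<Rightarrow> real"
  assumes nonneg: "\<And>k. 0 \<le> f k" and bound: "\<And>k. f k \<le> C" and q: "0 \<le> q" "q < 1"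
    and contr: "\<And>c e. 0 \<le> c \<Longrightarrow> 0 < e \<Longrightarrow> \<forall>\<^sub>F k in sequentially. f k \<le> c \<Longrightarrow>
      \<forall>\<^sub>F k in sequentially. f k \<le> q * c + e"
  shows "f \<longlonglongrightarrow> 0"
proof -
  \<comment> \<open>A factor strictly between \<open>q\<close> and \<open>1\<close> leaves room to absorb the error \<open>e\<close>.\<close>
  define p where "p = (1 + q) / 2"
  define D where "D = max C 1"
  have p: "q < p" "0 < p" "p < 1" and D: "0 < D" "C \<le> D"
    using q by (auto simp: p_def D_def)
  have geom: "\<forall>\<^sub>F k in sequentially. f k \<le> p ^ n * D" for n
  proof (induction n)
    case 0
    show ?case using bound D(2) by (auto intro!: always_eventually order_trans[OF bound])
  next
    case (Suc n)
    have "\<forall>\<^sub>F k in sequentially. f k \<le> q * (p ^ n * D) + (p - q) * (p ^ n * D)"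
      by (rule contr[OF _ _ Suc]) (use p D in auto)
    then show ?case by (simp add: algebra_simps)
  qed
  show ?thesis
  proof (rule order_tendstoI)
    show "\<forall>\<^sub>F k in sequentially. a < f k" if "a < 0" for a
      using that nonneg by (auto intro!: always_eventually intro: less_le_trans)
    show "\<forall>\<^sub>F k in sequentially. f k < a" if "0 < a" for a
    proof -
      have "(\<lambda>n. p ^ n * D) \<longlonglongrightarrow> 0"
        using LIMSEQ_power_zero[of p] p by (auto intro: tendsto_mult_left_zero)
      then have "\<forall>\<^sub>F n in sequentially. p ^ n * D < a"
        using that by (rule order_tendstoD)
      then obtain n where "p ^ n * D < a"
        by (auto simp: eventually_sequentially)
      with geom[of n] show ?thesis
        by (auto elim: eventually_mono)
    qed
  qed
qed

lemma eventually_const_if_of_bool_convergent: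
  assumes "(\<lambda>k. of_bool (P k) :: real) \<longlonglongrightarrow> l"
  shows "(\<forall>\<^sub>F k in sequentially. P k) \<or> (\<forall>\<^sub>F k in sequentially. \<not> P k)"
proof (cases "l < 1")
  case True
  from order_tendstoD(2)[OF assms True] show ?thesis
    by (auto elim!: eventually_mono)
next
  case False
  then have "0 < l" by simp
  from order_tendstoD(1)[OF assms this] show ?thesis
    by (auto elim!: eventually_mono)
qed

text \<open>A sequence of finite sets \<open>m l\<close> (the meshes) with weights \<open>w l x\<close> (the squared
  indicators) for which reduction on refined elements holds asymptotically. The weights are
  nonnegative everywhere, but only their values for \<open>x \<in> m l\<close> matter.\<close>

locale asymptotic_reduction =
  fixes m :: "nat \<Rightarrow> 'a set" and w :: "nat \<Rightarrow> 'a \<Rightarrow> real" and q C :: real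
  assumes finite_m: "finite (m l)"
    and w_nonneg: "0 \<le> w l x"
    and total_le: "sum (w l) (m l) \<le> C"
    and q: "0 \<le> q" "q < 1"
    and reduction: "0 < e \<Longrightarrow> \<exists>N. \<forall>i\<ge>N. \<forall>j\<ge>i.
      sum (w j) (m j - m i) \<le> q * sum (w i) (m i - m j) + e"
begin

text \<open>The elements that eventually stay in the sets with indices \<open>\<alpha> k\<close>, i.e. the set-theoretic
  lower limit.\<close>

definition lim_set :: "(nat \<Rightarrow> nat) \<Rightarrow> 'a set" where
  "lim_set \<alpha> = {x. \<forall>\<^sub>F k in sequentially. x \<in> m (\<alpha> k)}"

text \<open>Pointwise convergence of the sets \<open>m (\<alpha> k)\<close> along indices tending to infinity.
  Monotonicity of \<open>\<alpha>\<close> is not needed.\<close>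

definition settles :: "(nat \<Rightarrow> nat) \<Rightarrow> bool" where
  "settles \<alpha> \<longleftrightarrow> filterlim \<alpha> at_top sequentially \<and>
     (\<forall>x\<in>\<Union>(range m). (\<forall>\<^sub>F k in sequentially. x \<in> m (\<alpha> k)) \<or> (\<forall>\<^sub>F k in sequentially. x \<notin> m (\<alpha> k)))"

lemma sum_w_mono: "A \<subseteq> B \<Longrightarrow> B \<subseteq> m l \<Longrightarrow> sum (w l) A \<le> sum (w l) B"
  by (rule sum_mono2) (auto intro: w_nonneg finite_subset[OF _ finite_m])

lemma sum_w_le_C: "A \<subseteq> m l \<Longrightarrow> sum (w l) A \<le> C"
  using sum_w_mono[of A "m l" l] total_le[of l] by simp

lemma sum_w_Un_le:
  assumes "A \<subseteq> B1 \<union> B2" "B1 \<subseteq> m l" "B2 \<subseteq> m l"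
  shows "sum (w l) A \<le> sum (w l) B1 + sum (w l) B2"
proof -
  have fin: "finite B1" "finite B2"
    using assms finite_m by (auto intro: finite_subset)
  have "sum (w l) A \<le> sum (w l) (B1 \<union> B2)"
    using assms by (intro sum_w_mono) auto
  also have "\<dots> \<le> sum (w l) B1 + sum (w l) B2"
    using sum.union_inter[OF fin, of "w l"] by (simp add: sum_nonneg w_nonneg flip: add.assoc)
      (smt (verit) sum_nonneg w_nonneg)
  finally show ?thesis .
qed

lemma eventually_agree:
  assumes "settles \<alpha>"
  shows "\<forall>\<^sub>F k in sequentially. \<forall>x\<in>m l. x \<in> m (\<alpha> k) \<longleftrightarrow> x \<in> lim_set \<alpha>"
proof (rule eventually_ball_finite[OF finite_m], rule ballI)
  fix x assume "x \<in> m l"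
  then consider "\<forall>\<^sub>F k in sequentially. x \<in> m (\<alpha> k)" | "\<forall>\<^sub>F k in sequentially. x \<notin> m (\<alpha> k)"
    using assms by (auto simp: settles_def)
  then show "\<forall>\<^sub>F k in sequentially. x \<in> m (\<alpha> k) \<longleftrightarrow> x \<in> lim_set \<alpha>"
  proof cases
    case 1
    then show ?thesis by (auto simp: lim_set_def elim: eventually_mono)
  next
    case 2
    then have "x \<notin> lim_set \<alpha>"
      using eventually_happens[OF eventually_conj[OF 2, of "\<lambda>k. x \<in> m (\<alpha> k)"]]
      by (auto simp: lim_set_def)
    with 2 show ?thesis by (auto elim: eventually_mono)
  qed
qed

text \<open>For fixed \<open>i\<close>, the part of \<open>m (\<beta> i)\<close> missing from \<open>m (\<alpha> j)\<close> stabilizes as \<open>j\<close> grows, which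
  turns the right-hand side of the reduction property into a quantity depending on \<open>i\<close> only.\<close>

lemma eventually_reduction:
  assumes \<alpha>: "settles \<alpha>" and \<beta>: "settles \<beta>" and e: "0 < e"
  shows "\<forall>\<^sub>F i in sequentially. \<forall>\<^sub>F j in sequentially.
    sum (w (\<alpha> j)) (m (\<alpha> j) - m (\<beta> i)) \<le> q * sum (w (\<beta> i)) (m (\<beta> i) - lim_set \<alpha>) + e"
proof -
  obtain N where N: "\<And>i j. N \<le> i \<Longrightarrow> i \<le> j \<Longrightarrow>
      sum (w j) (m j - m i) \<le> q * sum (w i) (m i - m j) + e"
    using reduction[OF e] by auto
  have "\<forall>\<^sub>F i in sequentially. N \<le> \<beta> i"
    using \<beta> by (auto simp: settles_def filterlim_at_top)
  then show ?thesis
  proof (rule eventually_mono)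
    fix i assume i: "N \<le> \<beta> i"
    have "\<forall>\<^sub>F j in sequentially. \<beta> i \<le> \<alpha> j"
      using \<alpha> by (auto simp: settles_def filterlim_at_top)
    with eventually_agree[OF \<alpha>, of "\<beta> i"]
    show "\<forall>\<^sub>F j in sequentially. sum (w (\<alpha> j)) (m (\<alpha> j) - m (\<beta> i))
        \<le> q * sum (w (\<beta> i)) (m (\<beta> i) - lim_set \<alpha>) + e"
    proof eventually_elim
      case (elim j)
      then have "m (\<beta> i) - m (\<alpha> j) = m (\<beta> i) - lim_set \<alpha>" by auto
      with N[OF i elim(2)] show ?case by simp
    qed
  qed
qed

lemma transient_tendsto_0:
  assumes \<alpha>: "settles \<alpha>"
  shows "(\<lambda>k. sum (w (\<alpha> k)) (m (\<alpha> k) - lim_set \<alpha>)) \<longlonglongrightarrow> 0"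
proof (rule tendsto_0_if_eventual_contraction[OF _ _ q])
  fix c e :: real
  assume "0 \<le> c" and e: "0 < e"
    and c: "\<forall>\<^sub>F k in sequentially. sum (w (\<alpha> k)) (m (\<alpha> k) - lim_set \<alpha>) \<le> c"
  obtain i where i: "sum (w (\<alpha> i)) (m (\<alpha> i) - lim_set \<alpha>) \<le> c"
    "\<forall>\<^sub>F j in sequentially.
      sum (w (\<alpha> j)) (m (\<alpha> j) - m (\<alpha> i)) \<le> q * sum (w (\<alpha> i)) (m (\<alpha> i) - lim_set \<alpha>) + e"
    using eventually_happens[OF eventually_conj[OF c eventually_reduction[OF \<alpha> \<alpha> e]]] by auto
  from i(2) eventually_agree[OF \<alpha>, of "\<alpha> i"]
  show "\<forall>\<^sub>F k in sequentially. sum (w (\<alpha> k)) (m (\<alpha> k) - lim_set \<alpha>) \<le> q * c + e"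
  proof eventually_elim
    case (elim k)
    have "sum (w (\<alpha> k)) (m (\<alpha> k) - lim_set \<alpha>) \<le> sum (w (\<alpha> k)) (m (\<alpha> k) - m (\<alpha> i))"
      using elim(2) by (intro sum_w_mono) auto
    also have "\<dots> \<le> q * sum (w (\<alpha> i)) (m (\<alpha> i) - lim_set \<alpha>) + e" by (fact elim(1))
    also have "\<dots> \<le> q * c + e" using mult_left_mono[OF i(1) q(1)] by simp
    finally show ?case .
  qed
qed (auto intro: sum_nonneg w_nonneg sum_w_le_C)

text \<open>A tightness property: up to \<open>e\<close>, all weight is carried by a fixed finite set \<open>m (\<alpha> i)\<close>.\<close>

lemma new_elements_small:
  assumes \<alpha>: "settles \<alpha>" and e: "0 < e"
  obtains i where
    "\<forall>\<^sub>F k in sequentially. sum (w (\<alpha> k)) (m (\<alpha> k) - m (\<alpha> i)) \<le> e"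
proof -
  have e2: "0 < e / 2" using e by simp
  have "\<forall>\<^sub>F i in sequentially. sum (w (\<alpha> i)) (m (\<alpha> i) - lim_set \<alpha>) < e / 2"
    by (rule order_tendstoD(2)[OF transient_tendsto_0[OF \<alpha>] e2])
  then obtain i where i: "sum (w (\<alpha> i)) (m (\<alpha> i) - lim_set \<alpha>) < e / 2"
    "\<forall>\<^sub>F j in sequentially.
      sum (w (\<alpha> j)) (m (\<alpha> j) - m (\<alpha> i)) \<le> q * sum (w (\<alpha> i)) (m (\<alpha> i) - lim_set \<alpha>) + e / 2"
    using eventually_happens[OF eventually_conj[OF _ eventually_reduction[OF \<alpha> \<alpha> e2]]] by auto
  have "q * sum (w (\<alpha> i)) (m (\<alpha> i) - lim_set \<alpha>) \<le> 1 * (e / 2)"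
    using i(1) q by (intro mult_mono) (auto intro: sum_nonneg w_nonneg)
  with i(2) have "\<forall>\<^sub>F k in sequentially. sum (w (\<alpha> k)) (m (\<alpha> k) - m (\<alpha> i)) \<le> e"
    by (auto elim: eventually_mono)
  then show ?thesis by (rule that)
qed

text \<open>The exact factor \<open>q\<close> matters here. Covering \<open>m (\<alpha> k) - lim_set \<beta>\<close> by the sets of new elements
  relative to two of the sets \<open>m (\<beta> i)\<close> would only give \<open>2 * q\<close>; by tightness, one of them and
  a remainder of small weight suffice.\<close>

lemma eventually_cross_reduction:
  assumes \<alpha>: "settles \<alpha>" and \<beta>: "settles \<beta>" and c: "0 \<le> c" and e: "0 < e"
    and le: "\<forall>\<^sub>F k in sequentially. sum (w (\<beta> k)) (m (\<beta> k) - lim_set \<alpha>) \<le> c"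
  shows "\<forall>\<^sub>F k in sequentially. sum (w (\<alpha> k)) (m (\<alpha> k) - lim_set \<beta>) \<le> q * c + e"
proof -
  have e2: "0 < e / 2" using e by simp
  obtain n where n: "\<forall>\<^sub>F k in sequentially. sum (w (\<alpha> k)) (m (\<alpha> k) - m (\<alpha> n)) \<le> e / 2"
    by (rule new_elements_small[OF \<alpha> e2])
  \<comment> \<open>Late enough that no element of \<open>m (\<alpha> n)\<close> outside \<open>lim_set \<beta>\<close> is left in \<open>m (\<beta> i)\<close>.\<close>
  obtain i where i: "sum (w (\<beta> i)) (m (\<beta> i) - lim_set \<alpha>) \<le> c"
    "\<forall>x\<in>m (\<alpha> n). x \<in> m (\<beta> i) \<longleftrightarrow> x \<in> lim_set \<beta>"
    "\<forall>\<^sub>F j in sequentially.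
      sum (w (\<alpha> j)) (m (\<alpha> j) - m (\<beta> i)) \<le> q * sum (w (\<beta> i)) (m (\<beta> i) - lim_set \<alpha>) + e / 2"
    using eventually_happens[OF eventually_conj[OF le
        eventually_conj[OF eventually_agree[OF \<beta>, of "\<alpha> n"] eventually_reduction[OF \<alpha> \<beta> e2]]]]
    by auto
  from n i(3) show ?thesis
  proof eventually_elim
    case (elim k)
    have "sum (w (\<alpha> k)) (m (\<alpha> k) - lim_set \<beta>)
        \<le> sum (w (\<alpha> k)) (m (\<alpha> k) - m (\<alpha> n)) + sum (w (\<alpha> k)) (m (\<alpha> k) - m (\<beta> i))"
      using i(2) by (intro sum_w_Un_le) auto
    also have "\<dots> \<le> e / 2 + (q * sum (w (\<beta> i)) (m (\<beta> i) - lim_set \<alpha>) + e / 2)"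
      using elim by linarith
    also have "\<dots> \<le> q * c + e" using mult_left_mono[OF i(1) q(1)] by simp
    finally show ?case .
  qed
qed

lemma cross_transient_tendsto_0:
  assumes \<alpha>: "settles \<alpha>" and \<beta>: "settles \<beta>"
  shows "(\<lambda>k. sum (w (\<alpha> k)) (m (\<alpha> k) - lim_set \<beta>)) \<longlonglongrightarrow> 0"
proof -
  define f where "f = (\<lambda>k. max (sum (w (\<alpha> k)) (m (\<alpha> k) - lim_set \<beta>))
    (sum (w (\<beta> k)) (m (\<beta> k) - lim_set \<alpha>)))"
  have "f \<longlonglongrightarrow> 0"
  proof (rule tendsto_0_if_eventual_contraction[OF _ _ q])
    fix c e :: real
    assume "0 \<le> c" "0 < e" "\<forall>\<^sub>F k in sequentially. f k \<le> c"
    then show "\<forall>\<^sub>F k in sequentially. f k \<le> q * c + e"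
      using eventually_cross_reduction[OF \<alpha> \<beta>, of c e] eventually_cross_reduction[OF \<beta> \<alpha>, of c e]
      by (auto simp: f_def eventually_conj_iff)
  qed (auto simp: f_def intro: sum_nonneg w_nonneg sum_w_le_C max.coboundedI1)
  then show ?thesis
    by (rule tendsto_sandwich[OF _ _ tendsto_const, rotated 2])
      (auto simp: f_def intro!: always_eventually sum_nonneg w_nonneg)
qed

text \<open>Apart from the small weight outside the fixed finite set \<open>m (\<alpha> n)\<close>, what is missing from
  \<open>m (\<beta> k)\<close> for large \<open>k\<close> lies outside \<open>lim_set \<beta>\<close>.\<close>

lemma removed_tendsto_0_if_settles:
  assumes \<alpha>: "settles \<alpha>" and \<beta>: "settles \<beta>"
  shows "(\<lambda>k. sum (w (\<alpha> k)) (m (\<alpha> k) - m (\<beta> k))) \<longlonglongrightarrow> 0"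
proof (rule order_tendstoI)
  show "\<forall>\<^sub>F k in sequentially. a < sum (w (\<alpha> k)) (m (\<alpha> k) - m (\<beta> k))" if "a < 0" for a
    using that by (auto intro!: always_eventually less_le_trans[OF that] sum_nonneg w_nonneg)
next
  fix a :: real assume "0 < a"
  then have a2: "0 < a / 2" by simp
  obtain n where n: "\<forall>\<^sub>F k in sequentially. sum (w (\<alpha> k)) (m (\<alpha> k) - m (\<alpha> n)) \<le> a / 2"
    by (rule new_elements_small[OF \<alpha> a2])
  from n eventually_agree[OF \<beta>, of "\<alpha> n"]
    order_tendstoD(2)[OF cross_transient_tendsto_0[OF \<alpha> \<beta>] a2]
  show "\<forall>\<^sub>F k in sequentially. sum (w (\<alpha> k)) (m (\<alpha> k) - m (\<beta> k)) < a"
  proof eventually_elim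
    case (elim k)
    have "sum (w (\<alpha> k)) (m (\<alpha> k) - m (\<beta> k))
        \<le> sum (w (\<alpha> k)) (m (\<alpha> k) - m (\<alpha> n)) + sum (w (\<alpha> k)) (m (\<alpha> k) - lim_set \<beta>)"
      using elim(2) by (intro sum_w_Un_le) auto
    with elim(1,3) show ?case by linarith
  qed
qed

lemma common_settling_subsequence:
  assumes \<alpha>: "filterlim \<alpha> at_top sequentially" and \<beta>: "filterlim \<beta> at_top sequentially"
  obtains r where "strict_mono r" "settles (\<alpha> \<circ> r)" "settles (\<beta> \<circ> r)"
proof -
  \<comment> \<open>Both characteristic functions at once, so that one diagonal extraction suffices.\<close>
  define f where "f = (\<lambda>k x. (of_bool (x \<in> m (\<alpha> k)) :: real, of_bool (x \<in> m (\<beta> k)) :: real))"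
  have "countable (\<Union>(range m))"
    using finite_m by (auto intro: countable_finite)
  moreover have "norm (f k x) \<le> 2" for k x
    using norm_Pair_le[of "of_bool (x \<in> m (\<alpha> k)) :: real" "of_bool (x \<in> m (\<beta> k)) :: real"]
    by (auto simp: f_def)
  ultimately obtain r where r: "strict_mono r"
    and lim: "\<And>x. x \<in> \<Union>(range m) \<Longrightarrow> \<exists>l. (\<lambda>k. f (r k) x) \<longlonglongrightarrow> l"
    using function_convergent_subsequence[of "\<Union>(range m)" f 2] by metis
  have r_top: "filterlim r at_top sequentially"
    by (rule filterlim_subseq[OF r])
  have "settles (\<alpha> \<circ> r)"
    unfolding settles_def comp_def
  proof (intro conjI ballI)
    fix x assume "x \<in> \<Union>(range m)"
    then obtain l where "(\<lambda>k. f (r k) x) \<longlonglongrightarrow> l" using lim by blast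
    then have "(\<lambda>k. of_bool (x \<in> m (\<alpha> (r k))) :: real) \<longlonglongrightarrow> fst l"
      by (auto simp: f_def dest: tendsto_fst)
    then show "(\<forall>\<^sub>F k in sequentially. x \<in> m (\<alpha> (r k))) \<or> (\<forall>\<^sub>F k in sequentially. x \<notin> m (\<alpha> (r k)))"
      by (rule eventually_const_if_of_bool_convergent)
  qed (rule filterlim_compose[OF \<alpha> r_top])
  moreover have "settles (\<beta> \<circ> r)"
    unfolding settles_def comp_def
  proof (intro conjI ballI)
    fix x assume "x \<in> \<Union>(range m)"
    then obtain l where "(\<lambda>k. f (r k) x) \<longlonglongrightarrow> l" using lim by blast
    then have "(\<lambda>k. of_bool (x \<in> m (\<beta> (r k))) :: real) \<longlonglongrightarrow> snd l"
      by (auto simp: f_def dest: tendsto_snd)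
    then show "(\<forall>\<^sub>F k in sequentially. x \<in> m (\<beta> (r k))) \<or> (\<forall>\<^sub>F k in sequentially. x \<notin> m (\<beta> (r k)))"
      by (rule eventually_const_if_of_bool_convergent)
  qed (rule filterlim_compose[OF \<beta> r_top])
  ultimately show ?thesis using r that by blast
qed

lemma removed_tendsto_0: "(\<lambda>l. sum (w l) (m l - m (Suc l))) \<longlonglongrightarrow> 0"
proof (rule ccontr)
  assume "\<not> ?thesis"
  then obtain e where e: "0 < e" and "\<And>N. \<exists>l\<ge>N. e \<le> sum (w l) (m l - m (Suc l))"
    by (auto simp: LIMSEQ_def not_less sum_nonneg w_nonneg)
  then have "infinite {l. e \<le> sum (w l) (m l - m (Suc l))}"
    by (auto simp: infinite_nat_iff_unbounded_le)
  then obtain s :: "nat \<Rightarrow> nat" where s: "strict_mono s"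
    and large: "\<And>k. e \<le> sum (w (s k)) (m (s k) - m (Suc (s k)))"
    using infinite_enumerate by blast
  have s_top: "filterlim s at_top sequentially" by (rule filterlim_subseq[OF s])
  have Suc_top: "filterlim (\<lambda>k. Suc (s k)) at_top sequentially"
    by (rule filterlim_compose[OF filterlim_Suc s_top])
  obtain r where "settles (s \<circ> r)" "settles ((\<lambda>k. Suc (s k)) \<circ> r)"
    by (rule common_settling_subsequence[OF s_top Suc_top])
  from order_tendstoD(2)[OF removed_tendsto_0_if_settles[OF this] e]
  obtain k where "sum (w (s (r k))) (m (s (r k)) - m (Suc (s (r k)))) < e"
    by (auto simp: eventually_sequentially)
  with large[of "r k"] show False by simp
qed

end

section \<open>Meshes and estimators\<close>

lemma est_on_nonneg: "0 \<le> est_on \<xi> \<T> \<U>"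
  by (simp add: est_on_def sum_nonneg)

lemma est_on_sq: "(est_on \<xi> \<T> \<U>)\<^sup>2 = (\<Sum>T\<in>\<U>. (\<xi> \<T> T)\<^sup>2)"
  by (simp add: est_on_def sum_nonneg)

lemma est_on_sq_mono:
  "finite \<U>' \<Longrightarrow> \<U> \<subseteq> \<U>' \<Longrightarrow> (est_on \<xi> \<T> \<U>)\<^sup>2 \<le> (est_on \<xi> \<T> \<U>')\<^sup>2"
  unfolding est_on_sq by (rule sum_mono2) auto

lemma refinements_trans:
  assumes "\<T>'' \<in> refinements refine \<T>'" and "\<T>' \<in> refinements refine \<T>"
  shows "\<T>'' \<in> refinements refine \<T>"
  using assms by (induction) (auto intro: refinements.step)

lemma is_mesh_refinements:
  assumes "refinement_strategy \<Omega> refine" "is_mesh \<Omega> \<T>0" "\<T> \<in> refinements refine \<T>0"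
  shows "is_mesh \<Omega> \<T>"
  using assms(3) by induction (use assms(1,2) in \<open>auto simp: refinement_strategy_def\<close>)

lemma generated_refinements:
  assumes "generated_by_algorithm refine \<T>0 \<eta> \<zeta> (marking_strategy_B \<theta> W \<eta> \<zeta>) \<T>" and "i \<le> j"
  shows "\<T> j \<in> refinements refine (\<T> i)"
  using \<open>i \<le> j\<close>
proof (induction rule: dec_induct)
  case base
  show ?case by (rule refinements.base)
next
  case (step n)
  show ?case
  proof (cases "est \<eta> (\<T> n) * est \<zeta> (\<T> n) = 0")
    case True
    then have "\<T> (Suc n) = \<T> n" using assms(1) by (auto simp: generated_by_algorithm_def)
    with step show ?thesis by simp
  next
    case False
    then obtain \<M> where "\<M> \<subseteq> \<T> n" "\<T> (Suc n) = refine (\<T> n) \<M>"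
      using assms(1) unfolding generated_by_algorithm_def marking_strategy_B_def by metis
    with step show ?thesis by (auto intro: refinements.step)
  qed
qed

lemma perturbation_Cauchy:
  fixes x z :: "nat \<Rightarrow> 'x::real_normed_vector"
  assumes S: "perturbation_function S" and "Cauchy x" "Cauchy z" and e: "0 < e"
  shows "\<exists>N. \<forall>i\<ge>N. \<forall>j\<ge>i. (S (norm (x j - x i), norm (z j - z i)))\<^sup>2 \<le> e"
proof -
  have "((\<lambda>p. (S p)\<^sup>2) \<longlongrightarrow> 0) (at (0, 0) within quadrant)"
    using S unfolding perturbation_function_def continuous_within
    by (auto intro!: tendsto_eq_intros)
  then have "\<forall>\<^sub>F p in at (0, 0) within quadrant. (S p)\<^sup>2 < e"
    using e by (rule order_tendstoD)
  then obtain d where d: "0 < d"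
    "\<And>p. p \<in> quadrant \<Longrightarrow> p \<noteq> (0, 0) \<Longrightarrow> dist p (0, 0) < d \<Longrightarrow> (S p)\<^sup>2 < e"
    unfolding eventually_at by blast
  have d': "(S p)\<^sup>2 \<le> e" if "p \<in> quadrant" "norm p < d" for p
  proof (cases "p = (0, 0)")
    case True
    then show ?thesis using S e by (simp add: perturbation_function_def)
  next
    case False
    have "dist p (0, 0) < d" using that(2) by (simp flip: zero_prod_def)
    with d(2)[OF that(1) False] show ?thesis by simp
  qed
  have d2: "0 < d / 2" using d(1) by simp
  obtain N1 where N1: "\<And>i j. N1 \<le> i \<Longrightarrow> N1 \<le> j \<Longrightarrow> norm (x j - x i) < d / 2"
    using CauchyD[OF \<open>Cauchy x\<close> d2] by blast
  obtain N2 where N2: "\<And>i j. N2 \<le> i \<Longrightarrow> N2 \<le> j \<Longrightarrow> norm (z j - z i) < d / 2"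
    using CauchyD[OF \<open>Cauchy z\<close> d2] by blast
  show ?thesis
  proof (intro exI[of _ "max N1 N2"] allI impI d')
    fix i j assume "max N1 N2 \<le> i" "i \<le> j"
    then have "norm (x j - x i) < d / 2" "norm (z j - z i) < d / 2"
      using N1[of i j] N2[of i j] by auto
    then show "norm (norm (x j - x i), norm (z j - z i)) < d"
      using norm_Pair_le[of "norm (x j - x i)" "norm (z j - z i)"] by simp
  qed auto
qed

lemma perturbation_bounded:
  fixes x z :: "nat \<Rightarrow> 'x::real_normed_vector"
  assumes S: "perturbation_function S" and "Bseq x" "Bseq z"
  obtains B where "\<And>l. S (norm (x l - x 0), norm (z l - z 0)) \<le> B"
proof -
  \<comment> \<open>The arguments of \<open>S\<close> stay in a compact rectangle.\<close>
  obtain X where X: "\<And>l. norm (x l) \<le> X" using \<open>Bseq x\<close> by (auto simp: Bseq_def)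
  obtain Z where Z: "\<And>l. norm (z l) \<le> Z" using \<open>Bseq z\<close> by (auto simp: Bseq_def)
  have "compact ({0..2 * X} \<times> {0..2 * Z})" by (intro compact_Times compact_Icc)
  moreover have "{0..2 * X} \<times> {0..2 * Z} \<subseteq> quadrant" by auto
  ultimately have "bounded (S ` ({0..2 * X} \<times> {0..2 * Z}))"
    using S unfolding perturbation_function_def by blast
  then obtain B where B: "\<And>p. p \<in> {0..2 * X} \<times> {0..2 * Z} \<Longrightarrow> norm (S p) \<le> B"
    unfolding bounded_iff by blast
  have "S (norm (x l - x 0), norm (z l - z 0)) \<le> B" for l
  proof -
    have "norm (x l - x 0) \<le> 2 * X" "norm (z l - z 0) \<le> 2 * Z"
      using norm_triangle_ineq4[of "x l" "x 0"] norm_triangle_ineq4[of "z l" "z 0"]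
        X[of l] X[of 0] Z[of l] Z[of 0] by linarith+
    then have "norm (S (norm (x l - x 0), norm (z l - z 0))) \<le> B" by (intro B) auto
    then show ?thesis by simp
  qed
  then show ?thesis by (rule that)
qed

lemma estimator_bounded:
  fixes ud zd :: "'d mesh \<Rightarrow> 'x::real_normed_vector"
  assumes stability: "stability_on_nonrefined refine \<T>0 ud zd S \<xi>"
    and reduction: "reduction_on_refined refine \<T>0 ud zd q S \<xi>"
    and S: "perturbation_function S"
    and refs: "\<And>l. \<T> l \<in> refinements refine \<T>0" "\<T> 0 = \<T>0"
    and fin: "\<And>l. finite (\<T> l)"
    and q: "0 \<le> q" "q \<le> 1"
    and bounded: "Bseq (\<lambda>l. ud (\<T> l))" "Bseq (\<lambda>l. zd (\<T> l))"
  obtains C where "\<And>l. (est \<xi> (\<T> l))\<^sup>2 \<le> C"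
proof -
  obtain B where B: "\<And>l. S (norm (ud (\<T> l) - ud (\<T> 0)), norm (zd (\<T> l) - zd (\<T> 0))) \<le> B"
    using perturbation_bounded[OF S bounded] by blast
  have "(est \<xi> (\<T> l))\<^sup>2 \<le> (est \<xi> \<T>0 + B)\<^sup>2 + ((est \<xi> \<T>0)\<^sup>2 + B\<^sup>2)" for l
  proof -
    define s where "s = S (norm (ud (\<T> l) - ud \<T>0), norm (zd (\<T> l) - zd \<T>0))"
    have s: "0 \<le> s" "s \<le> B"
      using S B[of l] by (auto simp: s_def refs(2) perturbation_function_def)
    have le: "est_on \<xi> \<T>0 \<U> \<le> est \<xi> \<T>0" if "\<U> \<subseteq> \<T>0" for \<U>
      using est_on_sq_mono[OF _ that, of \<xi> \<T>0] fin[of 0] refs(2)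
      by (simp add: power2_le_iff_abs_le est_on_nonneg)
    have "est_on \<xi> (\<T> l) (\<T> l \<inter> \<T>0) \<le> est_on \<xi> \<T>0 (\<T> l \<inter> \<T>0) + s"
      using stability refs(1)[of l] refinements.base
      by (auto simp: stability_on_nonrefined_def s_def)
    also have "\<dots> \<le> est \<xi> \<T>0 + B" using le[of "\<T> l \<inter> \<T>0"] s by simp
    finally have kept: "(est_on \<xi> (\<T> l) (\<T> l \<inter> \<T>0))\<^sup>2 \<le> (est \<xi> \<T>0 + B)\<^sup>2"
      by (intro power_mono est_on_nonneg)
    have "(est_on \<xi> (\<T> l) (\<T> l - \<T>0))\<^sup>2 \<le> q * (est_on \<xi> \<T>0 (\<T>0 - \<T> l))\<^sup>2 + s\<^sup>2"
      using reduction refs(1)[of l] refinements.base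
      by (auto simp: reduction_on_refined_def s_def)
    also have "\<dots> \<le> 1 * (est \<xi> \<T>0)\<^sup>2 + B\<^sup>2"
      using q s le[of "\<T>0 - \<T> l"]
      by (intro add_mono mult_mono power_mono est_on_nonneg) auto
    finally have new: "(est_on \<xi> (\<T> l) (\<T> l - \<T>0))\<^sup>2 \<le> (est \<xi> \<T>0)\<^sup>2 + B\<^sup>2" by simp
    have "(est \<xi> (\<T> l))\<^sup>2
        = (est_on \<xi> (\<T> l) (\<T> l \<inter> \<T>0))\<^sup>2 + (est_on \<xi> (\<T> l) (\<T> l - \<T>0))\<^sup>2"
      unfolding est_on_sq by (rule sum.Int_Diff[OF fin])
    with kept new show ?thesis by simp
  qed
  then show ?thesis by (rule that)
qed

lemma removed_estimator_tendsto_0: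
  fixes ud zd :: "'d mesh \<Rightarrow> 'x::real_normed_vector"
  assumes reduction: "reduction_on_refined refine \<T>0 ud zd q S \<xi>"
    and S: "perturbation_function S"
    and refs: "\<And>l. \<T> l \<in> refinements refine \<T>0"
      "\<And>i j. i \<le> j \<Longrightarrow> \<T> j \<in> refinements refine (\<T> i)"
    and fin: "\<And>l. finite (\<T> l)"
    and q: "0 \<le> q" "q < 1"
    and Cauchy: "Cauchy (\<lambda>l. ud (\<T> l))" "Cauchy (\<lambda>l. zd (\<T> l))"
    and C: "\<And>l. (est \<xi> (\<T> l))\<^sup>2 \<le> C"
  shows "(\<lambda>l. (est_on \<xi> (\<T> l) (\<T> l - \<T> (Suc l)))\<^sup>2) \<longlonglongrightarrow> 0"
proof -
  interpret asymptotic_reduction \<T> "\<lambda>l T. (\<xi> (\<T> l) T)\<^sup>2" q C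
  proof
    fix e :: real assume "0 < e"
    from perturbation_Cauchy[OF S Cauchy this] obtain N where
      N: "\<And>i j. N \<le> i \<Longrightarrow> i \<le> j \<Longrightarrow>
        (S (norm (ud (\<T> j) - ud (\<T> i)), norm (zd (\<T> j) - zd (\<T> i))))\<^sup>2 \<le> e"
      by blast
    have "(est_on \<xi> (\<T> j) (\<T> j - \<T> i))\<^sup>2 \<le> q * (est_on \<xi> (\<T> i) (\<T> i - \<T> j))\<^sup>2 + e"
      if "N \<le> i" "i \<le> j" for i j
      using reduction refs(1)[of i] refs(2)[OF that(2)] N[OF that]
      unfolding reduction_on_refined_def by fastforce
    then show "\<exists>N. \<forall>i\<ge>N. \<forall>j\<ge>i. (\<Sum>T\<in>\<T> j - \<T> i. (\<xi> (\<T> j) T)\<^sup>2)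
        \<le> q * (\<Sum>T\<in>\<T> i - \<T> j. (\<xi> (\<T> i) T)\<^sup>2) + e"
      unfolding est_on_sq by blast
  qed (use fin q C in \<open>auto simp: est_on_sq\<close>)
  show ?thesis
    using removed_tendsto_0 by (simp add: est_on_sq)
qed

section \<open>Convergence of the estimator product\<close>

text \<open>Marking controls one of the two estimators by its marked part; the other one is estimated
  by \<open>C\<close>. Which one is controlled may change from step to step, hence the sum on the right.\<close>

lemma marking_B_product_le:
  assumes W: "marking_function C_W W" "0 < C_W"
    and marking: "marking_strategy_B \<theta> W \<eta> \<zeta> \<T> \<M>" and fin: "finite \<T>"
    and nz: "est \<eta> \<T> * est \<zeta> \<T> \<noteq> 0"
    and C: "(est \<eta> \<T>)\<^sup>2 \<le> C" "(est \<zeta> \<T>)\<^sup>2 \<le> C"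
  shows "(est \<eta> \<T> * est \<zeta> \<T>)\<^sup>2 \<le> C * C_W / \<theta> * ((est_on \<eta> \<T> \<M>)\<^sup>2 + (est_on \<zeta> \<T> \<M>)\<^sup>2)"
proof -
  define a b x y where "a = (est \<eta> \<T>)\<^sup>2" and "b = (est \<zeta> \<T>)\<^sup>2"
    and "x = (est_on \<eta> \<T> \<M>)\<^sup>2" and "y = (est_on \<zeta> \<T> \<M>)\<^sup>2"
  have ab: "0 < a" "0 < b" "a \<le> C" "b \<le> C" using nz C by (auto simp: a_def b_def)
  have \<M>: "\<M> \<subseteq> \<T>" "0 < \<theta>" "\<theta> \<le> W (x / a, y / b)"
    using marking by (auto simp: marking_strategy_B_def a_def b_def x_def y_def)
  have xy: "0 \<le> x" "x \<le> a" "0 \<le> y" "y \<le> b"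
    using est_on_sq_mono[OF fin \<M>(1)] by (auto simp: a_def b_def x_def y_def)
  have "x / a \<in> {0..1}" "y / b \<in> {0..1}" using xy ab by auto
  then have "\<theta> \<le> C_W * max (x / a) (y / b)"
    using W(1) \<M>(3) unfolding marking_function_def by (meson order_trans)
  then consider "\<theta> \<le> C_W * (x / a)" | "\<theta> \<le> C_W * (y / b)"
    by (auto simp: max_def split: if_splits)
  then have "\<theta> * (a * b) \<le> C * C_W * (x + y)"
  proof cases
    case 1
    then have "\<theta> * a \<le> C_W * x" using ab by (simp add: field_simps)
    also have "\<dots> \<le> C_W * (x + y)" using xy W(2) by simp
    finally have "\<theta> * a * b \<le> C_W * (x + y) * C"
      by (rule mult_mono) (use ab xy W(2) in auto)
    then show ?thesis by (simp add: ac_simps)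
  next
    case 2
    then have "\<theta> * b \<le> C_W * y" using ab by (simp add: field_simps)
    also have "\<dots> \<le> C_W * (x + y)" using xy W(2) by simp
    finally have "\<theta> * b * a \<le> C_W * (x + y) * C"
      by (rule mult_mono) (use ab xy W(2) in auto)
    then show ?thesis by (simp add: ac_simps)
  qed
  then show ?thesis
    using \<M>(2) by (simp add: a_def b_def x_def y_def power_mult_distrib field_simps)
qed

theorem mainTheorem3:
  fixes \<Omega> :: "(real ^ 'd) set"
    and val :: "'x::real_normed_vector \<Rightarrow> real ^ 'd \<Rightarrow> 'v::real_vector"
    and refine :: "'d mesh \<Rightarrow> 'd mesh \<Rightarrow> 'd mesh"
    and \<T>0 :: "'d mesh"
    and Xd :: "'d mesh \<Rightarrow> 'x set"
    and ud zd :: "'d mesh \<Rightarrow> 'x"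
    and \<eta> \<zeta> :: "'d indicators"
    and u :: 'x
    and G :: "'x \<Rightarrow> real"
    and Gd :: "'d mesh \<Rightarrow> real"
    and C_go q_red \<theta> C_W :: real
    and S W :: "real \<times> real \<Rightarrow> real"
    and \<T> :: "nat \<Rightarrow> 'd mesh"
  assumes domain: "bounded_Lipschitz_domain \<Omega>" "measure lebesgue \<Omega> > 0"
    and function_space: "function_space_on \<Omega> val"
    and initial_mesh: "is_mesh \<Omega> \<T>0"
    and refinement: "refinement_strategy \<Omega> refine"
    and discrete_spaces: "\<forall>\<T>H\<in>refinements refine \<T>0.
          subspace (Xd \<T>H) \<and> ud \<T>H \<in> Xd \<T>H \<and> zd \<T>H \<in> Xd \<T>H"
    and indicators: "\<forall>\<xi>\<in>{\<eta>, \<zeta>}. refinement_indicators refine \<T>0 \<xi>"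
    and goal: "continuous_on UNIV G" "C_go > 0"
          "\<forall>\<T>H\<in>refinements refine \<T>0. \<bar>G u - Gd \<T>H\<bar> \<le> C_go * (est \<eta> \<T>H * est \<zeta> \<T>H)"
    and q_red_range: "0 < q_red" "q_red < 1"
    and S: "perturbation_function S"
    and stability: "\<forall>\<xi>\<in>{\<eta>, \<zeta>}. stability_on_nonrefined refine \<T>0 ud zd S \<xi>"
    and reduction: "\<forall>\<xi>\<in>{\<eta>, \<zeta>}. reduction_on_refined refine \<T>0 ud zd q_red S \<xi>"
    and marking_prop: "marking_property refine \<T>0"
    and strategy_B: "0 < \<theta>" "\<theta> \<le> 1" "C_W > 0" "marking_function C_W W"
    and algorithm:
          "generated_by_algorithm refine \<T>0 \<eta> \<zeta> (marking_strategy_B \<theta> W \<eta> \<zeta>) \<T>"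
    and apriori_u: "\<exists>u_inf. (\<lambda>l. norm (u_inf - ud (\<T> l))) \<longlonglongrightarrow> 0"
    and apriori_z: "\<exists>z_inf. (\<lambda>l. norm (z_inf - zd (\<T> l))) \<longlonglongrightarrow> 0"
  shows "(\<lambda>l. est \<eta> (\<T> l) * est \<zeta> (\<T> l)) \<longlonglongrightarrow> 0"
proof -
  have refs: "\<T> j \<in> refinements refine (\<T> i)" if "i \<le> j" for i j
    by (rule generated_refinements[OF algorithm that])
  have T0: "\<T> 0 = \<T>0" using algorithm by (simp add: generated_by_algorithm_def)
  have refs0: "\<T> l \<in> refinements refine \<T>0" for l using refs[of 0 l] T0 by simp
  have fin: "finite (\<T> l)" for l
    using is_mesh_refinements[OF refinement initial_mesh refs0] by (simp add: is_mesh_def)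
  obtain u_inf z_inf where "(\<lambda>l. norm (u_inf - ud (\<T> l))) \<longlonglongrightarrow> 0"
    "(\<lambda>l. norm (z_inf - zd (\<T> l))) \<longlonglongrightarrow> 0"
    using apriori_u apriori_z by blast
  then have lim: "(\<lambda>l. ud (\<T> l)) \<longlonglongrightarrow> u_inf" "(\<lambda>l. zd (\<T> l)) \<longlonglongrightarrow> z_inf"
    by (subst tendsto_dist_iff, simp add: dist_norm norm_minus_commute)+
  have Cau: "Cauchy (\<lambda>l. ud (\<T> l))" "Cauchy (\<lambda>l. zd (\<T> l))"
    using lim by (blast intro: LIMSEQ_imp_Cauchy)+
  note q = less_imp_le[OF q_red_range(1)] q_red_range(2)
  have bound: "\<exists>C. \<forall>l. (est \<xi> (\<T> l))\<^sup>2 \<le> C" if "\<xi> \<in> {\<eta>, \<zeta>}" for \<xi>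
    using estimator_bounded[OF bspec[OF stability that] bspec[OF reduction that] S refs0 T0 fin q(1)
        less_imp_le[OF q(2)] Cauchy_Bseq[OF Cau(1)] Cauchy_Bseq[OF Cau(2)]] by metis
  obtain C1 C2 where C1: "\<And>l. (est \<eta> (\<T> l))\<^sup>2 \<le> C1" and C2: "\<And>l. (est \<zeta> (\<T> l))\<^sup>2 \<le> C2"
    using bound[of \<eta>] bound[of \<zeta>] by auto
  define C where "C = max C1 C2"
  have C: "(est \<eta> (\<T> l))\<^sup>2 \<le> C" "(est \<zeta> (\<T> l))\<^sup>2 \<le> C" for l
    using C1[of l] C2[of l] by (auto simp: C_def)
  have "0 \<le> C" using C(1)[of 0] zero_le_power2 order_trans by blast
  define R where "R = (\<lambda>\<xi> l. (est_on \<xi> (\<T> l) (\<T> l - \<T> (Suc l)))\<^sup>2)"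
  have R: "R \<eta> \<longlonglongrightarrow> 0" "R \<zeta> \<longlonglongrightarrow> 0"
    unfolding R_def using reduction
    by (blast intro: removed_estimator_tendsto_0[OF _ S refs0 refs fin q Cau] C)+
  have le: "(est \<eta> (\<T> l) * est \<zeta> (\<T> l))\<^sup>2 \<le> C * C_W / \<theta> * (R \<eta> l + R \<zeta> l)" for l
  proof (cases "est \<eta> (\<T> l) * est \<zeta> (\<T> l) = 0")
    \<comment> \<open>The algorithm has stopped.\<close>
    case True
    then show ?thesis
      unfolding True using \<open>0 \<le> C\<close> strategy_B by (simp add: R_def)
  next
    case False
    then obtain \<M> where \<M>: "marking_strategy_B \<theta> W \<eta> \<zeta> (\<T> l) \<M>" "\<T> (Suc l) = refine (\<T> l) \<M>"
      using algorithm unfolding generated_by_algorithm_def by metis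
    then have "\<M> \<subseteq> \<T> l - \<T> (Suc l)"
      using marking_prop refs0[of l] by (auto simp: marking_property_def marking_strategy_B_def)
    then have "(est_on \<xi> (\<T> l) \<M>)\<^sup>2 \<le> R \<xi> l" for \<xi>
      unfolding R_def using fin by (intro est_on_sq_mono) auto
    then have "C * C_W / \<theta> * ((est_on \<eta> (\<T> l) \<M>)\<^sup>2 + (est_on \<zeta> (\<T> l) \<M>)\<^sup>2)
        \<le> C * C_W / \<theta> * (R \<eta> l + R \<zeta> l)"
      using \<open>0 \<le> C\<close> strategy_B by (intro mult_left_mono add_mono) auto
    with marking_B_product_le[OF strategy_B(4,3) \<M>(1) fin False C] show ?thesis by linarith
  qed
  have "(\<lambda>l. C * C_W / \<theta> * (R \<eta> l + R \<zeta> l)) \<longlonglongrightarrow> 0"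
    using tendsto_mult_right_zero[OF tendsto_add_zero[OF R]] .
  then have "(\<lambda>l. (est \<eta> (\<T> l) * est \<zeta> (\<T> l))\<^sup>2) \<longlonglongrightarrow> 0"
    by (rule Lim_null_comparison[rotated]) (use le in \<open>simp add: always_eventually\<close>)
  then show ?thesis by simp
qed

end
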